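(* Let $q=p^s$ be a prime power, $m\ge1$ an integer, $r=q^m$, and let $e$ be a positive divisor of $q-1$ with $\gcd(m,e)=1$. Let $[n',k,d]$ be the parameters (length, dimension over $\mathbb{F}_q$, minimum Hamming distance) of the linear code $\phi(C_q(m,e))$ over $\mathbb{F}_q$. Then: (1) If $e=1$, then $\sum_{j=0}^{k-1}\left\lceil \frac{d}{q^j}\right\rceil=n'-1$. (2) If $e\ge2$, then $\phi(C_q(m,e))$ meets the Griesmer bound with equality, i.e. $\sum_{j=0}^{k-1}\left\lceil \frac{d}{q^j}\right\rceil=n'$.
   Context: Let $p$ be a prime, $q=p^s$, $r=q^m$ with $s,m\ge1$. Let $R=\mathbb{F}_q+u\mathbb{F}_q$ and $\mathcal{R}=\mathbb{F}_r+u\mathbb{F}_r$, where $u^2=0$. The trace $Tr:\mathcal{R}\to R$ is $Tr(a+ub)=Tr_{r/q}(a)+u\,Tr_{r/q}(b)$ for $a,b\in\mathbb{F}_r$, where $Tr_{r/q}$ is the trace function from $\mathbb{F}_r$ to $\mathbb{F}_q$. Let $\alpha$ be a generator of $\mathbb{F}_r^*$. For a positive divisor $e$ of $q-1$, let $C_0^{(e,r)}=\langle\alpha^e\rangle$ be the subgroup of $\mathbb{F}_r^*$ generated by $\alpha^e$, and let $L=C_0^{(e,r)}+u\mathbb{F}_r=\{t+ut' : t\in C_0^{(e,r)},\ t'\in\mathbb{F}_r\}\subseteq\mathcal{R}^*$, so $n:=|L|=\frac{r^2-r}{e}$. For $a\in\mathcal{R}$ put $ev(a)=(Tr(ax))_{x\in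 L}\in R^n$. The trace code is $C_q(m,e)=\{ev(a) : a\in\mathcal{R}\}\subseteq R^n$. The Gray map is the $\mathbb{F}_q$-linear bijection $\phi:R^n\to\mathbb{F}_q^{2n}$, $\phi(\mathbf{a}+u\mathbf{b})=(\mathbf{b},\mathbf{a}+\mathbf{b})$ for $\mathbf a,\mathbf b\in\mathbb{F}_q^n$. Thus $\phi(C_q(m,e))$ is a linear code over $\mathbb{F}_q$ of length $n'=2n=\frac{2(r^2-r)}{e}$. The Griesmer bound states that an $[N,k,d]$ linear code over $\mathbb{F}_q$ with $k\ge1$ satisfies $\sum_{j=0}^{k-1}\lceil d/q^j\rceil\le N$. *)

theory Defs
  imports "HOL-Analysis.Analysis" "HOL-Computational_Algebra.Primes"
begin

text \<open>The ring \<open>F + u F\<close> with \<open>u\<^sup>2 = 0\<close>; the element \<open>a + u b\<close> is \<open>Dual a b\<close>.\<close>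

datatype 'a dual_num = Dual (base: 'a) (eps: 'a)

instantiation dual_num :: (comm_ring_1) comm_ring_1
begin

definition zero_dual_num :: "'a dual_num" where "0 = Dual 0 0"
definition one_dual_num :: "'a dual_num" where "1 = Dual 1 0"
definition plus_dual_num :: "'a dual_num \<Rightarrow> 'a dual_num \<Rightarrow> 'a dual_num" where
  "x + y = Dual (base x + base y) (eps x + eps y)"
definition uminus_dual_num :: "'a dual_num \<Rightarrow> 'a dual_num" where
  "- x = Dual (- base x) (- eps x)"
definition minus_dual_num :: "'a dual_num \<Rightarrow> 'a dual_num \<Rightarrow> 'a dual_num" where
  "x - y = Dual (base x - base y) (eps x - eps y)"
definition times_dual_num :: "'a dual_num \<Rightarrow> 'a dual_num \<Rightarrow> 'a dual_num" where
  "x * y = Dual (base x * base y) (base x * eps y + eps x * base y)"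

instance
  by standard
    (auto simp: zero_dual_num_def one_dual_num_def plus_dual_num_def uminus_dual_num_def
      minus_dual_num_def times_dual_num_def algebra_simps)

end

lemma dual_unit_square: "Dual 0 1 * Dual 0 1 = (0 :: 'a::comm_ring_1 dual_num)"
  by (simp add: times_dual_num_def zero_dual_num_def)

lemma Dual_eq: "Dual a b = Dual a 0 + Dual 0 1 * Dual b (0 :: 'a::comm_ring_1)"
  by (simp add: times_dual_num_def plus_dual_num_def)

definition field_embedding :: "('k::field \<Rightarrow> 'l::field) \<Rightarrow> bool" where
  "field_embedding \<iota> \<longleftrightarrow> \<iota> 1 = 1 \<and> (\<forall>x y. \<iota> (x + y) = \<iota> x + \<iota> y) \<and> (\<forall>x y. \<iota> (x * y) = \<iota> x * \<iota> y)"

text \<open>The trace of an extension of degree \<open>m\<close> of the finite field \<open>'k\<close>, which is embedded in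
  \<open>'l\<close> by \<open>\<iota>\<close>. The sum of the conjugates lies in the image of \<open>\<iota>\<close>, and \<open>inv \<iota>\<close> pulls it back.\<close>

definition field_trace ::
  "('k::{field,finite} \<Rightarrow> 'l::{field,finite}) \<Rightarrow> nat \<Rightarrow> 'l \<Rightarrow> 'k" where
  "field_trace \<iota> m x = inv \<iota> (\<Sum>i<m. x ^ (CARD('k) ^ i))"

definition dual_trace ::
  "('k::{field,finite} \<Rightarrow> 'l::{field,finite}) \<Rightarrow> nat \<Rightarrow> 'l dual_num \<Rightarrow> 'k dual_num" where
  "dual_trace \<iota> m x = Dual (field_trace \<iota> m (base x)) (field_trace \<iota> m (eps x))"

definition mult_generator :: "'l::field \<Rightarrow> bool" where
  "mult_generator \<alpha> \<longleftrightarrow> range (\<lambda>i::int. \<alpha> powi i) = UNIV - {0}"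

definition cyclotomic_class :: "'l::field \<Rightarrow> nat \<Rightarrow> 'l set" where
  "cyclotomic_class \<alpha> e = range (\<lambda>i::int. (\<alpha> ^ e) powi i)"

definition defining_set :: "'l::field \<Rightarrow> nat \<Rightarrow> 'l dual_num set" where
  "defining_set \<alpha> e = {Dual t t' | t t'. t \<in> cyclotomic_class \<alpha> e}"

text \<open>Coordinates are labelled by a finite type \<open>'n\<close>; below, \<open>pt\<close> is a bijection from \<open>'n\<close> onto
  the defining set, so that words of length \<open>n = CARD('n)\<close> have one entry for each of its
  elements.\<close>

definition ev ::
  "('k::{field,finite} \<Rightarrow> 'l::{field,finite}) \<Rightarrow> nat \<Rightarrow> ('n::finite \<Rightarrow> 'l dual_num) \<Rightarrow>
    'l dual_num \<Rightarrow> 'k dual_num ^ 'n" where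
  "ev \<iota> m pt a = (\<chi> i. dual_trace \<iota> m (a * pt i))"

definition trace_code ::
  "('k::{field,finite} \<Rightarrow> 'l::{field,finite}) \<Rightarrow> nat \<Rightarrow> ('n::finite \<Rightarrow> 'l dual_num) \<Rightarrow>
    ('k dual_num ^ 'n) set" where
  "trace_code \<iota> m pt = range (ev \<iota> m pt)"

definition gray :: "'k::field dual_num ^ 'n::finite \<Rightarrow> 'k ^ ('n + 'n)" where
  "gray v = (\<chi> j. case j of Inl i \<Rightarrow> eps (v $ i) | Inr i \<Rightarrow> base (v $ i) + eps (v $ i))"

definition hamming_dist :: "'k ^ 'i::finite \<Rightarrow> 'k ^ 'i \<Rightarrow> nat" where
  "hamming_dist x y = card {i. x $ i \<noteq> y $ i}"

definition min_distance :: "('k ^ 'i::finite) set \<Rightarrow> nat" where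
  "min_distance C = Min {hamming_dist x y | x y. x \<in> C \<and> y \<in> C \<and> x \<noteq> y}"

definition code_length :: "('k ^ 'i::finite) set \<Rightarrow> nat" where
  "code_length C = CARD('i)"

end

theory Submission
  imports Defs
begin

text \<open>Write \<open>C0\<close> for the subgroup generated by \<open>\<alpha> ^ e\<close> and \<open>K\<close> for the number of elements of \<open>'l\<close>
  with nonzero trace. At \<open>x = t + u t'\<close> the word of \<open>a = a0 + u a1\<close> has the Gray coordinates
  \<open>Tr (a0 t' + a1 t)\<close> and \<open>Tr (a0 t' + (a0 + a1) t)\<close>. If \<open>a0 \<noteq> 0\<close>, both are equidistributed in
  \<open>t'\<close>, so the weight is \<open>2 (r - 1) K / e\<close>. If \<open>a0 = 0\<close>, the weight is \<open>2 r\<close> times the number of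
  \<open>t \<in> C0\<close> with \<open>Tr (a1 t) \<noteq> 0\<close>. As \<open>gcd m e = 1\<close>, every nonzero element of \<open>'l\<close> is a scalar
  from \<open>'k\<close> times an element of \<open>C0\<close>, so this number is \<open>K / e\<close> for every \<open>a1 \<noteq> 0\<close>. Hence the code
  has dimension \<open>2 m\<close> and minimum distance \<open>2 (r - 1) K / e\<close> with \<open>K = q ^ (m - 1) (q - 1)\<close>,
  and the Griesmer sum can be evaluated explicitly.\<close>


section \<open>Powers and characteristic in finite fields\<close>

text \<open>Translation by 1 permutes the ring, so adding 1 to every element leaves the sum over the
  ring unchanged.\<close>

lemma of_nat_CARD_eq_0: "of_nat CARD('a::{comm_ring_1,finite}) = (0::'a)"
proof -
  have "(\<Sum>x\<in>UNIV. x + 1) = (\<Sum>x\<in>UNIV. x :: 'a)"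
    by (rule sum.reindex_bij_witness[of _ "\<lambda>x. x - 1" "\<lambda>x. x + 1"]) auto
  thus ?thesis by (simp add: sum.distrib)
qed

lemma CHAR_eq_if_CARD_prime_power:
  assumes "prime p" "CARD('a::{field,finite}) = p ^ n"
  shows "CHAR('a) = p"
proof -
  have "CHAR('a) dvd p ^ n"
    using of_nat_CARD_eq_0[where 'a='a] assms(2) by (metis of_nat_eq_0_iff_char_dvd)
  moreover have "prime CHAR('a)"
    using finite_imp_CHAR_pos[where ?'a='a] prime_CHAR_semidom[where ?'a='a] by simp
  ultimately show ?thesis
    using assms(1) prime_dvd_power primes_dvd_imp_eq by blast
qed

text \<open>Multiplication by \<open>x\<close> permutes the nonzero elements, so it leaves their
  product unchanged.\<close>

lemma power_CARD_minus_1: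
  fixes x :: "'a::{field,finite}"
  assumes "x \<noteq> 0"
  shows "x ^ (CARD('a) - 1) = 1"
proof -
  let ?P = "\<Prod>y\<in>UNIV-{0}. y :: 'a"
  have "?P = (\<Prod>y\<in>UNIV-{0}. x * y)"
    by (rule prod.reindex_bij_witness[of _ "\<lambda>y. x * y" "\<lambda>y. y / x"]) (use assms in auto)
  also have "\<dots> = x ^ (CARD('a) - 1) * ?P"
    by (simp add: prod.distrib)
  finally show ?thesis by simp
qed

lemma power_CARD:
  fixes x :: "'a::{field,finite}"
  shows "x ^ CARD('a) = x"
proof (cases "x = 0")
  case False
  have "x ^ CARD('a) = x * x ^ (CARD('a) - 1)"
    by (subst power_Suc[symmetric]) simp
  with power_CARD_minus_1[OF False] show ?thesis by simp
qed simp

lemma CARD_field_ge_2: "CARD('a::{field,finite}) \<ge> 2"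
  using card_mono[of UNIV "{0, 1::'a}"] by simp

section \<open>Cyclotomic classes\<close>

text \<open>Exponents may be reduced modulo \<open>N\<close>; this replaces the integer exponents in
  the definitions by a finite range that can be counted.\<close>

lemma range_power_int_eq:
  fixes x :: "'a::field"
  assumes "x ^ N = 1" "N > 0"
  shows "range (\<lambda>i::int. x powi i) = (\<lambda>i. x ^ i) ` {..<N}"
proof -
  have x: "x \<noteq> 0" using assms by (auto simp: power_0_left)
  have "x powi i = x ^ nat (i mod int N)" for i
  proof -
    have "x powi i = x powi (int N * (i div int N) + i mod int N)" by simp
    also have "\<dots> = (x powi int N) powi (i div int N) * x powi (i mod int N)"
      using x by (subst power_int_add) (auto simp: power_int_mult)
    also have "\<dots> = x ^ nat (i mod int N)"
      using assms by (simp add: power_int_def)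
    finally show ?thesis .
  qed
  moreover have "nat (i mod int N) < N" for i
    using assms(2) by (simp add: nat_less_iff)
  moreover have "x ^ i = x powi int i" for i by simp
  ultimately show ?thesis by (auto simp only: image_iff lessThan_iff)
qed

lemma generator_nonzero:
  assumes "mult_generator (\<alpha> :: 'l::{field,finite})"
  shows "\<alpha> \<noteq> 0"
proof -
  have "\<alpha> powi 1 \<in> UNIV - {0}"
    using assms unfolding mult_generator_def by blast
  thus ?thesis by simp
qed

text \<open>The powers of \<open>\<alpha>\<close> with exponent below \<open>CARD('l) - 1\<close>
  are distinct, since they fill a set of that size; hence so are the powers of
  \<open>\<alpha> ^ e\<close> with exponent below \<open>N\<close>.\<close>

lemma card_cyclotomic_class:
  fixes \<alpha> :: "'l::{field,finite}"
  assumes "mult_generator \<alpha>" "e dvd CARD('l) - 1"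
  shows "e * card (cyclotomic_class \<alpha> e) = CARD('l) - 1"
proof -
  let ?r1 = "CARD('l) - 1"
  have r1: "?r1 > 0" using CARD_field_ge_2[where 'a='l] by simp
  have \<alpha>: "\<alpha> ^ ?r1 = 1"
    using generator_nonzero[OF assms(1)] by (rule power_CARD_minus_1)
  have "(\<lambda>i. \<alpha> ^ i) ` {..<?r1} = UNIV - {0}"
    using range_power_int_eq[OF \<alpha> r1] assms(1) by (simp add: mult_generator_def)
  hence inj: "inj_on (\<lambda>i. \<alpha> ^ i) {..<?r1}"
    by (intro eq_card_imp_inj_on) auto
  from assms(2) obtain N where N: "?r1 = e * N" by blast
  have "e > 0" "N > 0" using N r1 by auto
  have "cyclotomic_class \<alpha> e = (\<lambda>i. (\<alpha> ^ e) ^ i) ` {..<N}"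
    unfolding cyclotomic_class_def
    by (rule range_power_int_eq) (use \<alpha> N \<open>N > 0\<close> in \<open>auto simp flip: power_mult\<close>)
  moreover have "inj_on (\<lambda>i. (\<alpha> ^ e) ^ i) {..<N}"
  proof (rule inj_onI)
    fix i j assume "i \<in> {..<N}" "j \<in> {..<N}" "(\<alpha> ^ e) ^ i = (\<alpha> ^ e) ^ j"
    hence "e * i = e * j"
      using N \<open>e > 0\<close> by (intro inj_onD[OF inj]) (auto simp flip: power_mult)
    thus "i = j" using \<open>e > 0\<close> by simp
  qed
  ultimately have "card (cyclotomic_class \<alpha> e) = N" by (simp add: card_image)
  with N show ?thesis by simp
qed

lemma cyclotomic_class_mult_image:
  fixes \<alpha> :: "'l::{field,finite}"
  assumes "\<alpha> \<noteq> 0" "y \<in> cyclotomic_class \<alpha> e"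
  shows "(\<lambda>t. y * t) ` cyclotomic_class \<alpha> e = cyclotomic_class \<alpha> e"
proof (rule endo_inj_surj)
  from assms obtain i where i: "y = (\<alpha> ^ e) powi i" by (auto simp: cyclotomic_class_def)
  show "(\<lambda>t. y * t) ` cyclotomic_class \<alpha> e \<subseteq> cyclotomic_class \<alpha> e"
    using assms(1) by (auto simp: cyclotomic_class_def i simp flip: power_int_add)
  show "inj_on (\<lambda>t. y * t) (cyclotomic_class \<alpha> e)"
    using assms(1) by (auto simp: i inj_on_def)
qed auto

lemma cyclotomic_class_1: "1 \<in> cyclotomic_class \<alpha> e"
  unfolding cyclotomic_class_def by (rule range_eqI[of _ _ 0]) simp

text \<open>Since \<open>q\<close> is 1 modulo \<open>e\<close>, each of the \<open>m\<close>
  summands is 1, so the sum is congruent to \<open>m\<close>.\<close>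

lemma coprime_geometric_sum:
  fixes q e m :: nat
  assumes "e dvd q - 1" "coprime m e" "q > 0"
  shows "coprime (\<Sum>i<m. q ^ i) e"
proof -
  have q: "q mod e = 1 mod e"
    using assms(1,3) mod_eq_dvd_iff_nat[of 1 q e] by auto
  have "q ^ i mod e = 1 mod e" for i
    using power_mod[of q e i] power_mod[of 1 e i] q by simp
  hence "(\<Sum>i<m. q ^ i) mod e = (\<Sum>i<m. 1 mod e) mod e"
    by (subst mod_sum_eq[symmetric]) simp
  also have "\<dots> = m mod e"
    by (subst mod_sum_eq) simp
  finally show ?thesis using assms(2)
    by (metis coprime_iff_gcd_eq_1 gcd_red_nat gcd.commute)
qed

section \<open>Dimension from cardinality\<close>

lemma card_span_independent:
  fixes B :: "('k::{field,finite} ^ 'i::finite) set"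
  assumes "vec.independent B"
  shows "card (vec.span B) = CARD('k) ^ card B"
proof -
  have "finite B" using assms by (rule vec.finiteI_independent)
  thus ?thesis using assms
  proof (induction B)
    case (insert b B)
    have ind: "vec.independent B" "b \<notin> vec.span B"
      using insert by (auto simp: vec.independent_insert)
    let ?f = "\<lambda>(c, v). c *s b + v"
    have "vec.span (insert b B) = ?f ` (UNIV \<times> vec.span B)"
    proof (intro equalityI subsetI)
      fix x assume "x \<in> vec.span (insert b B)"
      then obtain c where "x - c *s b \<in> vec.span B" by (auto simp: vec.span_breakdown_eq)
      thus "x \<in> ?f ` (UNIV \<times> vec.span B)"
        by (intro image_eqI[of _ _ "(c, x - c *s b)"]) auto
    qed (auto simp: vec.span_breakdown_eq, metis add_diff_cancel_left')
    moreover have "inj_on ?f (UNIV \<times> vec.span B)"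
    proof (rule inj_onI, clarify)
      fix c d v w assume vw: "v \<in> vec.span B" "w \<in> vec.span B" and eq: "c *s b + v = d *s b + w"
      have "(c - d) *s b = w - v"
        using eq by (simp add: vec.scale_left_diff_distrib algebra_simps)
      hence "(c - d) *s b \<in> vec.span B" using vw by (simp add: vec.span_diff)
      \<comment> \<open>If \<open>c\<close> and \<open>d\<close> differed, dividing by
        \<open>c - d\<close> would put \<open>b\<close> into the span of \<open>B\<close>.\<close>
      hence "inverse (c - d) *s ((c - d) *s b) \<in> vec.span B" by (rule vec.span_scale)
      hence "c \<noteq> d \<Longrightarrow> b \<in> vec.span B" by (simp only: vec.scale_scale) simp
      with ind(2) have "c = d" by blast
      with eq show "c = d \<and> v = w" by simp
    qed
    ultimately show ?case
      using insert ind by (simp add: card_image card_cartesian_product)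
  qed simp
qed

lemma card_subspace:
  fixes C :: "('k::{field,finite} ^ 'i::finite) set"
  assumes "vec.subspace C"
  shows "card C = CARD('k) ^ vec.dim C"
proof -
  obtain B where B: "B \<subseteq> C" "vec.independent B" "C \<subseteq> vec.span B" "card B = vec.dim C"
    by (rule vec.basis_exists)
  hence "vec.span B = C" using assms vec.span_minimal by blast
  with card_span_independent[OF B(2)] B(4) show ?thesis by simp
qed


section \<open>The trace of a finite field extension\<close>

locale finite_field_extension =
  fixes \<iota> :: "'k::{field,finite} \<Rightarrow> 'l::{field,finite}" and m p s q :: nat
  assumes embedding: "field_embedding \<iota>"
    and m_pos: "m \<ge> 1"
    and p: "prime p"
    and q: "q = p ^ s"
    and CARD_k: "CARD('k) = q"
    and CARD_l: "CARD('l) = q ^ m"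
begin

abbreviation "Tr \<equiv> field_trace \<iota> m"

lemma q_ge_2: "q \<ge> 2"
  using CARD_field_ge_2[where 'a='k] by (simp add: CARD_k)

lemma power_q: "x ^ q = (x :: 'k)"
  using power_CARD[of x] by (simp add: CARD_k)

lemma emb_add: "\<iota> (x + y) = \<iota> x + \<iota> y" and emb_mult: "\<iota> (x * y) = \<iota> x * \<iota> y"
  and emb_1: "\<iota> 1 = 1"
  using embedding by (auto simp: field_embedding_def)

lemma emb_0: "\<iota> 0 = 0"
  using emb_add[of 0 0] by (metis add.right_neutral add_left_cancel)

lemma emb_power: "\<iota> (x ^ i) = \<iota> x ^ i"
  by (induction i) (auto simp: emb_1 emb_mult)

lemma emb_diff: "\<iota> (x - y) = \<iota> x - \<iota> y"
  using emb_add[of "x - y" y] by simp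

lemma emb_eq_0_iff: "\<iota> x = 0 \<longleftrightarrow> x = 0"
proof
  assume "\<iota> x = 0"
  moreover have "x \<noteq> 0 \<Longrightarrow> \<iota> x * \<iota> (inverse x) = 1"
    by (simp flip: emb_mult add: emb_1)
  ultimately show "x = 0" by auto
qed (simp add: emb_0)

lemma inj_emb: "inj \<iota>"
proof (rule injI)
  fix x y assume "\<iota> x = \<iota> y"
  hence "\<iota> (x - y) = 0" by (simp add: emb_diff)
  thus "x = y" by (simp add: emb_eq_0_iff)
qed

lemma CHAR_l: "CHAR('l) = p"
  by (rule CHAR_eq_if_CARD_prime_power[of _ "s * m"]) (use p q CARD_l in \<open>auto simp: power_mult\<close>)

lemma frobenius_add: "(x + y :: 'l) ^ (q ^ i) = x ^ (q ^ i) + y ^ (q ^ i)"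
  by (rule freshmans_dream'[of _ "s * i"]) (use p q CHAR_l in \<open>auto simp: power_mult\<close>)

lemma frobenius_sum: "(sum f A :: 'l) ^ q = (\<Sum>i\<in>A. f i ^ q)"
  by (rule freshmans_dream_sum'[of _ s]) (use p q CHAR_l in auto)

lemma emb_fixed: "\<iota> c ^ (q ^ i) = \<iota> c"
proof (induction i)
  case (Suc i)
  thus ?case by (simp add: power_mult power_q flip: emb_power)
qed simp

text \<open>The \<open>q\<close> elements of the image are roots of \<open>X^q - X\<close>, which
  has at most \<open>q\<close> roots. This is the test for lying in the subfield.\<close>

lemma range_emb: "range \<iota> = {x. x ^ q = x}"
proof (rule card_seteq)
  let ?P = "monom 1 q - monom 1 1 :: 'l poly"
  have "coeff ?P q = 1" using q_ge_2 by simp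
  hence "?P \<noteq> 0" by (metis coeff_0 zero_neq_one)
  hence "card {x. poly ?P x = 0} \<le> degree ?P" by (rule card_poly_roots_bound)
  also have "degree ?P \<le> q"
    using q_ge_2 by (intro degree_diff_le) (auto intro: order_trans[OF degree_monom_le])
  finally show "card {x :: 'l. x ^ q = x} \<le> card (range \<iota>)"
    by (simp add: poly_monom card_image inj_emb CARD_k)
qed (use emb_fixed[of _ 1] in auto)

text \<open>The sum of conjugates is fixed by the Frobenius map, hence lies in the image of
  \<open>\<iota>\<close>, where \<open>inv \<iota>\<close> really is an inverse.\<close>

lemma emb_trace: "\<iota> (Tr x) = (\<Sum>i<m. x ^ (q ^ i))"
proof -
  obtain m' where m': "m = Suc m'" using m_pos by (cases m) auto
  have "(\<Sum>i<m. x ^ (q ^ i)) ^ q = (\<Sum>i<m. x ^ (q ^ Suc i))"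
    by (simp add: frobenius_sum mult.commute[of q] flip: power_mult)
  \<comment> \<open>The conjugates are shifted cyclically: the last term,
    \<open>x ^ (q ^ m)\<close>, equals \<open>x\<close>, the first one.\<close>
  also have "\<dots> = (\<Sum>i<m. x ^ (q ^ i))"
    unfolding m' sum.lessThan_Suc[of "\<lambda>i. x ^ (q ^ Suc i)"] sum.lessThan_Suc_shift[of "\<lambda>i. x ^ (q ^ i)"]
    using power_CARD[of x] CARD_l by (simp add: m')
  finally have "(\<Sum>i<m. x ^ (q ^ i)) \<in> range \<iota>" by (simp add: range_emb)
  thus ?thesis unfolding field_trace_def CARD_k by (rule f_inv_into_f)
qed

lemma trace_add: "Tr (x + y) = Tr x + Tr y"
  by (rule injD[OF inj_emb]) (simp add: emb_trace emb_add frobenius_add sum.distrib)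

lemma trace_scale: "Tr (\<iota> c * x) = c * Tr x"
  by (rule injD[OF inj_emb])
     (simp add: emb_trace emb_mult power_mult_distrib emb_fixed sum_distrib_left)

lemma trace_diff: "Tr (x - y) = Tr x - Tr y"
  using trace_add[of "x - y" y] by simp

lemma trace_0: "Tr 0 = 0"
  using trace_add[of 0 0] by (metis add.right_neutral add_left_cancel)

text \<open>Otherwise a nonzero polynomial of degree at most \<open>q ^ (m - 1)\<close> would vanish
  at all \<open>q ^ m\<close> elements.\<close>

lemma trace_nonzero: "\<exists>x. Tr x \<noteq> 0"
proof (rule ccontr)
  assume "\<not> ?thesis"
  hence 0: "(\<Sum>i<m. x ^ (q ^ i)) = 0" for x :: 'l
    using emb_trace[of x] by (simp add: emb_0)
  let ?P = "\<Sum>i<m. monom 1 (q ^ i) :: 'l poly"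
  have "coeff ?P 1 = (\<Sum>i<m. if i = 0 then 1 else 0)"
    unfolding coeff_sum by (intro sum.cong) (use q_ge_2 in auto)
  also have "\<dots> = 1" using m_pos by simp
  finally have "?P \<noteq> 0" by auto
  hence "card {x. poly ?P x = 0} \<le> degree ?P" by (rule card_poly_roots_bound)
  also have "{x. poly ?P x = 0} = UNIV" using 0 by (simp add: poly_sum poly_monom)
  also have "degree ?P \<le> q ^ (m - 1)"
    using q_ge_2
    by (intro degree_sum_le order_trans[OF degree_monom_le] power_increasing) auto
  also have "q ^ (m - 1) < q ^ m"
    using q_ge_2 m_pos by (intro power_strict_increasing) auto
  finally show False by (simp add: CARD_l)
qed

definition "num_trace_nonzero = card {x. Tr x \<noteq> 0}"

text \<open>The trace is onto, and its \<open>q\<close> fibres are translates of the kernel, so each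
  has \<open>q ^ (m - 1)\<close> elements.\<close>

lemma num_trace_nonzero_eq: "num_trace_nonzero = q ^ (m - 1) * (q - 1)"
proof -
  obtain z where z: "Tr z \<noteq> 0" using trace_nonzero by blast
  have fib: "card {x. Tr x = c} = card {x. Tr x = 0}" for c
  proof -
    have "Tr (\<iota> (c / Tr z) * z) = c" using z by (simp add: trace_scale)
    then obtain y where y: "Tr y = c" by blast
    have "bij_betw (\<lambda>x. x - y) {x. Tr x = c} {x. Tr x = 0}"
      by (rule bij_betwI[of _ _ _ "\<lambda>x. x + y"]) (auto simp: trace_diff trace_add y)
    thus ?thesis by (rule bij_betw_same_card)
  qed
  have "CARD('l) = card (\<Union>c. {x. Tr x = c})" by (intro arg_cong[of _ _ card]) auto
  also have "\<dots> = (\<Sum>c\<in>UNIV. card {x. Tr x = c})"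
    by (rule card_UN_disjoint) auto
  also have "\<dots> = q * card {x. Tr x = 0}" by (subst fib) (simp add: CARD_k)
  finally have "q * q ^ (m - 1) = q * card {x. Tr x = 0}"
    using m_pos by (simp add: CARD_l flip: power_Suc)
  hence ker: "card {x. Tr x = 0} = q ^ (m - 1)" using q_ge_2 by simp
  have "num_trace_nonzero = card (UNIV - {x. Tr x = 0})"
    unfolding num_trace_nonzero_def by (intro arg_cong[of _ _ card]) auto
  also have "\<dots> = q ^ m - q ^ (m - 1)" by (subst card_Diff_subset) (auto simp: CARD_l ker)
  also have "\<dots> = q * q ^ (m - 1) - q ^ (m - 1)" using m_pos by (simp flip: power_Suc)
  finally show ?thesis by (simp add: algebra_simps)
qed

lemma card_trace_affine_nonzero:
  assumes "a \<noteq> 0"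
  shows "card {x. Tr (a * x + b) \<noteq> 0} = num_trace_nonzero"
proof -
  have "bij_betw (\<lambda>x. a * x + b) {x. Tr (a * x + b) \<noteq> 0} {x. Tr x \<noteq> 0}"
    by (rule bij_betwI[of _ _ _ "\<lambda>y. (y - b) / a"]) (use assms in auto)
  thus ?thesis unfolding num_trace_nonzero_def by (rule bij_betw_same_card)
qed

end

section \<open>Scalars, cyclotomic classes and traces\<close>

locale trace_code_setting = finite_field_extension \<iota> m p s q
  for \<iota> :: "'k::{field,finite} \<Rightarrow> 'l::{field,finite}" and m p s q +
  fixes \<alpha> :: 'l and e :: nat and pt :: "'n::finite \<Rightarrow> 'l dual_num"
  assumes generator: "mult_generator \<alpha>"
    and e_pos: "e > 0"
    and e_dvd: "e dvd q - 1"
    and coprime_m_e: "coprime m e"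
    and pt: "bij_betw pt UNIV (defining_set \<alpha> e)"
begin

abbreviation "C0 \<equiv> cyclotomic_class \<alpha> e"

lemma \<alpha>_nonzero: "\<alpha> \<noteq> 0"
  using generator by (rule generator_nonzero)

lemma CARD_l_minus_1: "CARD('l) - 1 = (q - 1) * (\<Sum>i<m. q ^ i)"
proof -
  \<comment> \<open>The detour through \<open>int\<close> avoids truncated subtraction in the
    geometric sum formula.\<close>
  have "int (CARD('l) - 1) = int ((q - 1) * (\<Sum>i<m. q ^ i))"
    using power_diff_1_eq[of "int q" m] q_ge_2 by (simp add: CARD_l of_nat_diff Suc_le_eq)
  thus ?thesis by linarith
qed

lemma card_C0: "e * card C0 = CARD('l) - 1"
  using e_dvd by (intro card_cyclotomic_class generator) (simp only: CARD_l_minus_1 dvd_mult2)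

text \<open>A Bezout identity for \<open>g = (r - 1) / (q - 1)\<close> and \<open>e\<close> splits
  any power of \<open>\<alpha>\<close> into a power of \<open>\<alpha> ^ g\<close>, which lies in
  the subfield, and a power of \<open>\<alpha> ^ e\<close>.\<close>

lemma emb_times_C0:
  assumes "b \<noteq> 0"
  obtains c t where "c \<noteq> 0" "t \<in> C0" "b = \<iota> c * t"
proof -
  define g where "g = (\<Sum>i<m. q ^ i)"
  have "coprime g e"
    unfolding g_def using e_dvd coprime_m_e by (rule coprime_geometric_sum) (use q_ge_2 in simp)
  then obtain x y where xy: "x * int g + y * int e = 1"
    using bezout_int[of "int g" "int e"] by auto
  obtain j where j: "b = \<alpha> powi j"
    using assms generator unfolding mult_generator_def by blast
  define u where "u = (\<alpha> ^ g) powi (x * j)"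
  have "j = (x * int g + y * int e) * j" using xy by simp
  also have "\<dots> = int g * (x * j) + int e * (y * j)" by (simp add: algebra_simps)
  finally have j': "j = int g * (x * j) + int e * (y * j)" .
  have b: "b = u * (\<alpha> ^ e) powi (y * j)"
    unfolding j u_def power_int_power
    by (subst power_int_add[symmetric]) (use \<alpha>_nonzero j' in auto)
  \<comment> \<open>As \<open>g * (q - 1) = CARD('l) - 1\<close>, the factor \<open>u\<close> is
    fixed by the \<open>q\<close>-th power map and so comes from a scalar.\<close>
  have "(\<alpha> ^ g) ^ (q - 1) = 1"
    using power_CARD_minus_1[OF \<alpha>_nonzero]
    by (simp only: CARD_l_minus_1 g_def mult.commute flip: power_mult)
  hence "(\<alpha> ^ g) ^ q = \<alpha> ^ g"
    using power_Suc[of "\<alpha> ^ g" "q - 1"] q_ge_2 by simp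
  hence "u ^ q = u"
    unfolding u_def by (metis mult.commute power_int_power power_int_power')
  hence "u \<in> range \<iota>" by (simp add: range_emb)
  then obtain c where c: "u = \<iota> c" by blast
  have "u \<noteq> 0" using \<alpha>_nonzero by (simp add: u_def)
  hence "c \<noteq> 0" by (auto simp: c emb_0)
  moreover have "(\<alpha> ^ e) powi (y * j) \<in> C0" by (auto simp: cyclotomic_class_def)
  ultimately show thesis using that b c by blast
qed

text \<open>By \<open>emb_times_C0\<close> the number of \<open>t\<close> in \<open>C0\<close> with \<open>Tr (b * t) \<noteq> 0\<close> does not depend on
  \<open>b \<noteq> 0\<close>; double counting the pairs \<open>(b, t)\<close> then gives its value.\<close>

lemma card_C0_trace_nonzero:
  assumes "b \<noteq> 0"
  shows "e * card {t\<in>C0. Tr (b * t) \<noteq> 0} = num_trace_nonzero"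
proof -
  define M where "M b = card {t\<in>C0. Tr (b * t) \<noteq> 0}" for b
  have M1: "M b = M 1" if b: "b \<noteq> 0" for b
  proof -
    obtain c y where cy: "c \<noteq> 0" "y \<in> C0" "b = \<iota> c * y" using emb_times_C0[OF b] by blast
    have im: "(\<lambda>t. y * t) ` C0 = C0" by (rule cyclotomic_class_mult_image[OF \<alpha>_nonzero cy(2)])
    have "y \<noteq> 0" using b cy by auto
    \<comment> \<open>Multiplication by \<open>y\<close> permutes \<open>C0\<close>, and the nonzero
      scalar \<open>c\<close> does not affect whether the trace vanishes.\<close>
    have "bij_betw (\<lambda>t. y * t) {t\<in>C0. Tr (b * t) \<noteq> 0} {t\<in>C0. Tr (1 * t) \<noteq> 0}"
      unfolding bij_betw_def
    proof
      show "inj_on (\<lambda>t. y * t) {t\<in>C0. Tr (b * t) \<noteq> 0}"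
        using \<open>y \<noteq> 0\<close> by (auto simp: inj_on_def)
      have "Tr (b * t) = c * Tr (y * t)" for t by (simp add: cy(3) mult.assoc trace_scale)
      thus "(\<lambda>t. y * t) ` {t\<in>C0. Tr (b * t) \<noteq> 0} = {t\<in>C0. Tr (1 * t) \<noteq> 0}"
        using cy(1) im by auto
    qed
    thus ?thesis unfolding M_def by (rule bij_betw_same_card)
  qed
  have C0_nonzero: "t \<noteq> 0" if "t \<in> C0" for t
    using that \<alpha>_nonzero by (auto simp: cyclotomic_class_def)
  have "(\<Sum>b\<in>UNIV-{0}. M b) = (\<Sum>b\<in>UNIV-{0::'l}. M 1)"
    by (rule sum.cong) (use M1 in blast)+
  hence "(CARD('l) - 1) * M 1 = (\<Sum>b\<in>UNIV-{0}. M b)" by simp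
  \<comment> \<open>The term for \<open>b = 0\<close> vanishes because
    \<open>Tr 0 = 0\<close>.\<close>
  also have "\<dots> = (\<Sum>b\<in>UNIV. M b)"
    by (rule sum.mono_neutral_left) (auto simp: M_def trace_0)
  also have "\<dots> = card (SIGMA b:UNIV. {t\<in>C0. Tr (b * t) \<noteq> 0})"
    unfolding M_def by (subst card_SigmaI) auto
  \<comment> \<open>Now \<open>t\<close> is fixed first; the added 0 gives the condition the shape
    of \<open>card_trace_affine_nonzero\<close>.\<close>
  also have "\<dots> = card (SIGMA t:C0. {b. Tr (t * b + 0) \<noteq> 0})"
    by (rule bij_betw_same_card[of prod.swap])
       (rule bij_betwI[of _ _ _ prod.swap], auto simp: mult.commute)
  also have "\<dots> = card C0 * num_trace_nonzero"
    using C0_nonzero by (subst card_SigmaI) (simp_all add: card_trace_affine_nonzero del: add_0_right)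
  finally have "card C0 * (e * M 1) = card C0 * num_trace_nonzero"
    unfolding card_C0[symmetric] by (simp only: mult_ac)
  moreover have "card C0 > 0"
    using cyclotomic_class_1[of \<alpha> e] by (auto simp: card_gt_0_iff)
  ultimately have "e * M 1 = num_trace_nonzero" by (simp add: card_gt_0_iff)
  thus ?thesis using M1[OF assms] by (simp only: M_def)
qed

section \<open>Weights of codewords\<close>

text \<open>One count serves both Gray halves of a codeword: they share the slope \<open>a\<close>
  in \<open>t'\<close> and differ only in \<open>b\<close>.\<close>

definition "affine_weight a b = card {i. Tr (a * eps (pt i) + b * base (pt i)) \<noteq> 0}"

lemma bij_betw_coordinates:
  "bij_betw (\<lambda>i. (base (pt i), eps (pt i))) UNIV (C0 \<times> UNIV)"
proof -
  have "bij_betw (\<lambda>x. (base x, eps x)) (defining_set \<alpha> e) (C0 \<times> UNIV)"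
    by (rule bij_betwI[of _ _ _ "\<lambda>(t, t'). Dual t t'"]) (auto simp: defining_set_def)
  from bij_betw_trans[OF pt this] show ?thesis by (simp add: o_def)
qed

lemma affine_weight_eq:
  "affine_weight a b = card (SIGMA t:C0. {t'. Tr (a * t' + b * t) \<noteq> 0})"
proof -
  let ?g = "\<lambda>i. (base (pt i), eps (pt i))"
  have "bij_betw ?g {i. Tr (a * eps (pt i) + b * base (pt i)) \<noteq> 0}
    (SIGMA t:C0. {t'. Tr (a * t' + b * t) \<noteq> 0})"
  proof (rule bij_betw_subset[OF bij_betw_coordinates])
    have im: "?g ` UNIV = C0 \<times> UNIV"
      using bij_betw_coordinates by (simp add: bij_betw_def)
    show "?g ` {i. Tr (a * eps (pt i) + b * base (pt i)) \<noteq> 0} =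
      (SIGMA t:C0. {t'. Tr (a * t' + b * t) \<noteq> 0})"
    proof (intro equalityI subsetI)
      fix z assume z: "z \<in> (SIGMA t:C0. {t'. Tr (a * t' + b * t) \<noteq> 0})"
      hence "z \<in> ?g ` UNIV" unfolding im by auto
      then obtain i where "z = ?g i" by blast
      thus "z \<in> ?g ` {i. Tr (a * eps (pt i) + b * base (pt i)) \<noteq> 0}" using z by auto
    next
      fix z assume z: "z \<in> ?g ` {i. Tr (a * eps (pt i) + b * base (pt i)) \<noteq> 0}"
      hence "z \<in> C0 \<times> UNIV" unfolding im[symmetric] by blast
      thus "z \<in> (SIGMA t:C0. {t'. Tr (a * t' + b * t) \<noteq> 0})" using z by auto
    qed
  qed auto
  thus ?thesis unfolding affine_weight_def by (rule bij_betw_same_card)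
qed

text \<open>For each fixed \<open>t\<close> the term \<open>b * t\<close> is a constant shift, so
  every \<open>t\<close> contributes \<open>num_trace_nonzero\<close>.\<close>

lemma affine_weight_nonzero_slope:
  assumes "a \<noteq> 0"
  shows "e * affine_weight a b = (CARD('l) - 1) * num_trace_nonzero"
  unfolding affine_weight_eq card_C0[symmetric]
  by (subst card_SigmaI) (simp_all add: card_trace_affine_nonzero[OF assms])

text \<open>The condition involves only \<open>t\<close>, so \<open>t'\<close> is free and
  contributes the factor \<open>CARD('l)\<close>.\<close>

lemma affine_weight_zero_slope:
  assumes "b \<noteq> 0"
  shows "e * affine_weight 0 b = CARD('l) * num_trace_nonzero"
proof -
  have "affine_weight 0 b = card ({t\<in>C0. Tr (b * t) \<noteq> 0} \<times> (UNIV :: 'l set))"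
    unfolding affine_weight_eq by (rule arg_cong[of _ _ card]) auto
  thus ?thesis
    using card_C0_trace_nonzero[OF assms] by (simp add: card_cartesian_product mult.assoc[symmetric])
qed

lemma CARD_n: "e * CARD('n) = (CARD('l) - 1) * CARD('l)"
proof -
  have "CARD('n) = card C0 * CARD('l)"
    using bij_betw_same_card[OF bij_betw_coordinates] by (simp add: card_cartesian_product)
  thus ?thesis unfolding card_C0[symmetric] by (simp only: mult.assoc)
qed

definition "codeword a = gray (ev \<iota> m pt a)"

lemma codeword_nth:
  "codeword a $ Inl i = Tr (base a * eps (pt i) + eps a * base (pt i))"
  "codeword a $ Inr i = Tr (base a * eps (pt i) + (base a + eps a) * base (pt i))"
  by (simp_all add: codeword_def gray_def ev_def dual_trace_def times_dual_num_def algebra_simps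
      trace_add)

lemma codeword_eqI:
  assumes "\<And>i. v $ Inl i = codeword a $ Inl i" "\<And>i. v $ Inr i = codeword a $ Inr i"
  shows "codeword a = v"
  unfolding vec_eq_iff using assms by (metis sum.exhaust)

lemma codeword_add: "codeword (a + b) = codeword a + codeword b"
  by (rule codeword_eqI) (simp_all add: codeword_nth plus_dual_num_def algebra_simps trace_add)

lemma codeword_diff: "codeword (a - b) = codeword a - codeword b"
  using codeword_add[of "a - b" b] by simp

lemma codeword_scale: "codeword (Dual (\<iota> c) 0 * a) = c *s codeword a"
proof (rule codeword_eqI)
  have *: "c * Tr (x * y + z * w) = Tr (\<iota> c * x * y + \<iota> c * z * w)" for x y z w
    by (simp add: distrib_left mult.assoc flip: trace_scale)
  show "(c *s codeword a) $ Inl i = codeword (Dual (\<iota> c) 0 * a) $ Inl i" for i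
    by (simp add: codeword_nth times_dual_num_def *)
  show "(c *s codeword a) $ Inr i = codeword (Dual (\<iota> c) 0 * a) $ Inr i" for i
    by (simp add: codeword_nth times_dual_num_def * distrib_left)
qed

text \<open>Both halves have slope \<open>base a\<close>. If it is 0, both have the coefficient
  \<open>eps a\<close>, which is then nonzero.\<close>

lemma codeword_weight:
  assumes "a \<noteq> 0"
  shows "e * card {j. codeword a $ j \<noteq> 0} =
    2 * (if base a = 0 then CARD('l) else CARD('l) - 1) * num_trace_nonzero"
proof -
  have "{j. codeword a $ j \<noteq> 0} =
      Inl ` {i. codeword a $ Inl i \<noteq> 0} \<union> Inr ` {i. codeword a $ Inr i \<noteq> 0}"
    by (auto simp: image_iff) (metis sum.exhaust)
  hence "card {j. codeword a $ j \<noteq> 0} =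
      card {i. codeword a $ Inl i \<noteq> 0} + card {i. codeword a $ Inr i \<noteq> 0}"
    by (simp only:, subst card_Un_disjoint) (auto simp: card_image)
  also have "\<dots> = affine_weight (base a) (eps a) + affine_weight (base a) (base a + eps a)"
    by (simp add: affine_weight_def codeword_nth)
  finally have w: "e * card {j. codeword a $ j \<noteq> 0} =
      e * affine_weight (base a) (eps a) + e * affine_weight (base a) (base a + eps a)"
    by (simp add: distrib_left)
  show ?thesis
  proof (cases "base a = 0")
    case True
    hence "eps a \<noteq> 0" using assms by (cases a) (auto simp: zero_dual_num_def)
    thus ?thesis using True w by (simp add: affine_weight_zero_slope)
  next
    case False
    thus ?thesis using w by (simp add: affine_weight_nonzero_slope)
  qed
qed

section \<open>Dimension and minimum distance\<close>

text \<open>A nonzero \<open>a - b\<close> would yield a codeword of positive weight.\<close>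

lemma inj_codeword: "inj codeword"
proof (rule injI, rule ccontr)
  fix a b assume eq: "codeword a = codeword b" and "a \<noteq> b"
  hence "a - b \<noteq> 0" by simp
  from codeword_weight[OF this] have "num_trace_nonzero = 0"
    using CARD_field_ge_2[where 'a='l] by (simp add: codeword_diff eq split: if_splits)
  thus False using q_ge_2 by (simp add: num_trace_nonzero_eq)
qed

lemma gray_trace_code_eq: "gray ` trace_code \<iota> m pt = range codeword"
  by (auto simp: trace_code_def codeword_def)

text \<open>By injectivity the code has \<open>q ^ (2 * m)\<close> words, and a subspace of
  dimension \<open>k\<close> has \<open>q ^ k\<close> elements.\<close>

lemma dim_gray_trace_code: "vec.dim (gray ` trace_code \<iota> m pt) = 2 * m"
proof -
  let ?C = "range codeword"
  have "vec.subspace ?C"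
  proof (rule vec.subspaceI)
    show "0 \<in> ?C" using codeword_diff[of 0 0] by (intro range_eqI[of _ _ 0]) simp
  qed (auto simp flip: codeword_add codeword_scale)
  hence "card ?C = q ^ vec.dim ?C" by (simp add: card_subspace CARD_k)
  moreover have "bij_betw (\<lambda>(t, t'). Dual t t') (UNIV \<times> UNIV) (UNIV :: 'l dual_num set)"
    by (rule bij_betwI[of _ _ _ "\<lambda>x. (base x, eps x)"]) auto
  hence "card (UNIV :: 'l dual_num set) = q ^ (2 * m)"
    by (simp add: bij_betw_same_card[symmetric] card_cartesian_product CARD_l mult_2 power_add)
  hence "card ?C = q ^ (2 * m)" by (simp add: card_image inj_codeword)
  ultimately show ?thesis using q_ge_2 by (simp add: gray_trace_code_eq)
qed

lemma min_distance_gray_trace_code: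
  "e * min_distance (gray ` trace_code \<iota> m pt) = 2 * (CARD('l) - 1) * num_trace_nonzero"
proof -
  let ?wt = "\<lambda>a. card {j. codeword a $ j \<noteq> 0}"
  have dist: "hamming_dist (codeword a) (codeword b) = ?wt (a - b)" for a b
    by (simp add: hamming_dist_def codeword_diff)
  have D: "{hamming_dist x y | x y. x \<in> range codeword \<and> y \<in> range codeword \<and> x \<noteq> y} = ?wt ` (UNIV - {0})"
  proof (intro equalityI subsetI)
    fix v assume "v \<in> ?wt ` (UNIV - {0})"
    then obtain a where "a \<noteq> 0" "v = hamming_dist (codeword a) (codeword 0)"
      by (auto simp: dist)
    moreover from this have "codeword a \<noteq> codeword 0" using inj_codeword by (auto dest: injD)
    ultimately show
      "v \<in> {hamming_dist x y | x y. x \<in> range codeword \<and> y \<in> range codeword \<and> x \<noteq> y}"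
      by blast
  qed (auto simp: dist)
  \<comment> \<open>The base part of 1 is nonzero, so 1 attains the smaller of the two
    weights.\<close>
  have "Min (?wt ` (UNIV - {0})) = ?wt 1"
  proof (rule Min_eqI)
    show "finite (?wt ` (UNIV - {0}))"
      by (rule finite_subset[of _ "{..CARD('n + 'n)}"]) (auto intro!: card_mono simp del: card_sum)
    show "?wt 1 \<in> ?wt ` (UNIV - {0})" by (intro imageI) simp
    fix v assume "v \<in> ?wt ` (UNIV - {0})"
    then obtain a where a: "a \<noteq> 0" "v = ?wt a" by blast
    have "e * ?wt 1 \<le> e * v"
      unfolding a(2) codeword_weight[OF a(1)] codeword_weight[OF one_neq_zero]
      by (intro mult_mono) (auto simp: one_dual_num_def)
    thus "?wt 1 \<le> v" using e_pos by simp
  qed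
  thus ?thesis
    using codeword_weight[OF one_neq_zero]
    by (simp add: min_distance_def gray_trace_code_eq D one_dual_num_def)
qed

end

section \<open>Evaluation of the Griesmer sum\<close>

text \<open>The first \<open>m\<close> quotients are integers. In the others the part
  \<open>c * q ^ m\<close> still divides exactly, and the ceiling of minus the remaining fraction
  gives the floors \<open>c div q ^ Suc i\<close>.\<close>

lemma griesmer_sum_eq:
  fixes c q m d :: nat
  assumes q: "q \<ge> 2" and m: "m \<ge> 1" and d: "d = c * (q ^ m - 1) * q ^ (m - 1)"
  shows "(\<Sum>j<2 * m. \<lceil>real d / real q ^ j\<rceil>) =
    int (c * (\<Sum>i<m. q ^ i) * q ^ m) - (\<Sum>i<m. int (c div q ^ Suc i))"
proof -
  define S where "S = (\<Sum>i<m. q ^ i)"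
  have S: "(\<Sum>i<m. q ^ (m - Suc i)) = S"
    unfolding S_def by (rule sum.nat_diff_reindex)
  have lo: "\<lceil>real d / real q ^ j\<rceil> = int (c * (q ^ m - 1) * q ^ (m - Suc j))" if "j < m" for j
  proof -
    have "q ^ (m - 1) = q ^ (m - Suc j) * q ^ j" using that by (simp flip: power_add)
    hence "real d / real q ^ j = real (c * (q ^ m - 1) * q ^ (m - Suc j))"
      using q by (simp add: d field_simps)
    thus ?thesis by (metis ceiling_of_nat)
  qed
  have hi: "\<lceil>real d / real q ^ (m + i)\<rceil> = int (c * q ^ (m - Suc i)) - int (c div q ^ Suc i)"
    if "i < m" for i
  proof -
    have 1: "real q ^ m = real q ^ (m - Suc i) * real q ^ Suc i"
      using that by (simp flip: power_add power_Suc)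
    have 2: "real q ^ m = real q ^ (m - 1) * real q" using m by (simp flip: power_Suc2)
    have "real d = real c * (real q ^ m - 1) * real q ^ (m - 1)"
      using q by (simp add: d of_nat_diff)
    hence "real d / real q ^ (m + i) = real c * (real q ^ m - 1) / real q ^ Suc i"
      using q by (simp add: power_add 2 field_simps)
    also have "\<dots> = real c * real q ^ (m - Suc i) - real c / real q ^ Suc i"
      using q by (simp add: 1 field_simps)
    also have "\<dots> = of_int (int (c * q ^ (m - Suc i))) - real c / real (q ^ Suc i)" by simp
    finally have "\<lceil>real d / real q ^ (m + i)\<rceil> =
        int (c * q ^ (m - Suc i)) - \<lfloor>real c / real (q ^ Suc i)\<rfloor>"
      by (simp only: ceiling_def minus_diff_eq floor_diff_of_int)
    thus ?thesis by (simp only: floor_divide_of_nat_eq)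
  qed
  have split: "(\<Sum>j<m + n. f j) = (\<Sum>j<m. f j) + (\<Sum>i<n. f (m + i))" for n and f :: "nat \<Rightarrow> int"
    by (induction n) auto
  have "(\<Sum>j<2 * m. \<lceil>real d / real q ^ j\<rceil>) =
      int (c * (q ^ m - 1) * (\<Sum>i<m. q ^ (m - Suc i))) +
      (int (c * (\<Sum>i<m. q ^ (m - Suc i))) - (\<Sum>i<m. int (c div q ^ Suc i)))"
    by (simp only: mult_2 split) (simp add: lo hi sum_subtractf sum_distrib_left)
  \<comment> \<open>The two halves contribute \<open>c * S * (q ^ m - 1)\<close> and
    \<open>c * S\<close>, apart from the floors.\<close>
  also have "\<dots> = int (c * S * (q ^ m - 1 + 1)) - (\<Sum>i<m. int (c div q ^ Suc i))"
    unfolding S by (simp add: algebra_simps)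
  also have "q ^ m - 1 + 1 = q ^ m" using q by simp
  finally show ?thesis by (simp only: S_def)
qed

theorem theorem3p5:
  fixes p s q m r e n' k d :: nat
    and \<iota> :: "'k::{field,finite} \<Rightarrow> 'l::{field,finite}"
    and \<alpha> :: 'l
    and pt :: "'n::finite \<Rightarrow> 'l dual_num"
    and C :: "('k ^ ('n + 'n)) set"
  assumes "prime p" and "s \<ge> 1" and "m \<ge> 1"
    and "q = p ^ s" and "r = q ^ m"
    and "CARD('k) = q" and "CARD('l) = r"
    and "field_embedding \<iota>"
    and "mult_generator \<alpha>"
    and "e > 0" and "e dvd q - 1" and "gcd m e = 1"
    and "bij_betw pt UNIV (defining_set \<alpha> e)"
    and "C = gray ` trace_code \<iota> m pt"
    and "n' = code_length C" and "k = vec.dim C" and "d = min_distance C"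
  shows "(e = 1 \<longrightarrow> (\<Sum>j<k. \<lceil>real d / real q ^ j\<rceil>) = int n' - 1) \<and>
         (e \<ge> 2 \<longrightarrow> (\<Sum>j<k. \<lceil>real d / real q ^ j\<rceil>) = int n')"
proof -
  interpret trace_code_setting \<iota> m p s q \<alpha> e pt
    using assms by unfold_locales (auto simp: coprime_iff_gcd_eq_1)
  obtain c where c: "q - 1 = e * c" using e_dvd by blast
  have k: "k = 2 * m" using assms dim_gray_trace_code by simp
  have "e * d = e * (2 * c * (q ^ m - 1) * q ^ (m - 1))"
    using min_distance_gray_trace_code
    unfolding \<open>d = min_distance C\<close> \<open>C = _\<close> num_trace_nonzero_eq CARD_l c by (simp only: mult_ac)
  hence d: "d = 2 * c * (q ^ m - 1) * q ^ (m - 1)" using e_pos by simp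
  have "e * CARD('n) = e * (c * (\<Sum>i<m. q ^ i) * q ^ m)"
    unfolding CARD_n CARD_l_minus_1 unfolding CARD_l c by (simp add: mult_ac)
  hence n': "n' = 2 * c * (\<Sum>i<m. q ^ i) * q ^ m"
    using e_pos assms by (simp add: code_length_def)
  \<comment> \<open>The constant of \<open>griesmer_sum_eq\<close> is \<open>2 * c\<close>, that is
    \<open>2 * (q - 1) / e\<close>, so only its quotients by powers of \<open>q\<close> separate the
    two cases.\<close>
  have sum: "(\<Sum>j<k. \<lceil>real d / real q ^ j\<rceil>) =
      int n' - (\<Sum>i<m. int (2 * c div q ^ Suc i))"
    unfolding k n' by (rule griesmer_sum_eq[OF q_ge_2 m_pos d])
  show ?thesis
  proof (intro conjI impI)
    assume "e = 1"
    have "2 * c div q ^ Suc i = (if i = 0 then 1 else 0)" for i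
    proof (cases i)
      case 0
      \<comment> \<open>Here \<open>2 * c = 2 * (q - 1)\<close> lies between \<open>q\<close> and
        \<open>2 * q - 1\<close>; this quotient is the whole defect 1.\<close>
      have "2 * c div q = 1"
        by (rule div_nat_eqI) (use c \<open>e = 1\<close> q_ge_2 in auto)
      thus ?thesis using 0 by simp
    next
      case (Suc i')
      have "2 * c < 2 * q" using c \<open>e = 1\<close> q_ge_2 by simp
      also have "\<dots> \<le> q ^ 2" using q_ge_2 by (simp add: power2_eq_square)
      also have "\<dots> \<le> q ^ Suc i" using q_ge_2 Suc by (intro power_increasing) auto
      finally show ?thesis using Suc by simp
    qed
    hence "(\<Sum>i<m. int (2 * c div q ^ Suc i)) = (\<Sum>i<m. if i = 0 then 1 else 0)"
      by (intro sum.cong) auto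
    thus "(\<Sum>j<k. \<lceil>real d / real q ^ j\<rceil>) = int n' - 1" using sum m_pos by simp
  next
    assume "e \<ge> 2"
    have "2 * c div q ^ Suc i = 0" for i
    proof -
      \<comment> \<open>Now \<open>2 * c\<close> is at most \<open>e * c = q - 1\<close>, so every
        floor vanishes.\<close>
      have "2 * c \<le> e * c" using \<open>e \<ge> 2\<close> by simp
      also have "\<dots> < q ^ 1" using c q_ge_2 by simp
      also have "\<dots> \<le> q ^ Suc i" using q_ge_2 by (intro power_increasing) auto
      finally show ?thesis by simp
    qed
    thus "(\<Sum>j<k. \<lceil>real d / real q ^ j\<rceil>) = int n'" using sum by simp
  qed
qed

end
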